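(* Let $\ell$ be an integer and $k$ an odd integer with $5 \le k < 2\ell$. Then for every integer $n \ge 3$, $$\mathrm{ex}(n, \mathcal{C}_{2\ell} \cup \{C_k\}) \ge \mathrm{z}(n, \mathcal{C}_{2\ell}) + 1.$$
   Context: Graphs are finite and simple. $C_j$ denotes the cycle of length $j$, and $\mathcal{C}_{2\ell} = \{C_4, C_6, \dots, C_{2\ell}\}$. A graph is $\mathcal{F}$-free if it contains no member of the family $\mathcal{F}$ as a (not necessarily induced) subgraph. $\mathrm{ex}(n,\mathcal{F})$ is the maximum number of edges in an $\mathcal{F}$-free graph on $n$ vertices; $\mathrm{z}(n,\mathcal{F})$ is the maximum number of edges in an $\mathcal{F}$-free bipartite graph on $n$ vertices. *)

theory Defs
  imports Main
begin

type_synonym 'a graph = "'a set \<times> 'a set set"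

abbreviation verts :: "'a graph \<Rightarrow> 'a set" where
  "verts \<equiv> fst"

abbreviation edges :: "'a graph \<Rightarrow> 'a set set" where
  "edges \<equiv> snd"

definition simple_graph :: "'a graph \<Rightarrow> bool" where
  "simple_graph G \<longleftrightarrow> finite (verts G) \<and> (\<forall>e \<in> edges G. e \<subseteq> verts G \<and> card e = 2)"

text \<open>The subgraph need not be induced: edges of H are mapped to edges of G, but nothing is
  required of the non-edges of H.\<close>

definition contains_subgraph :: "'a graph \<Rightarrow> 'b graph \<Rightarrow> bool" where
  "contains_subgraph G H \<longleftrightarrow>
     (\<exists>f. inj_on f (verts H) \<and> f ` verts H \<subseteq> verts G \<and> (\<forall>e \<in> edges H. f ` e \<in> edges G))"

definition free_of :: "'b graph set \<Rightarrow> 'a graph \<Rightarrow> bool" where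
  "free_of F G \<longleftrightarrow> (\<forall>H \<in> F. \<not> contains_subgraph G H)"

definition bipartite :: "'a graph \<Rightarrow> bool" where
  "bipartite G \<longleftrightarrow>
     (\<exists>A B. A \<union> B = verts G \<and> A \<inter> B = {} \<and>
        (\<forall>e \<in> edges G. \<exists>a \<in> A. \<exists>b \<in> B. e = {a, b}))"

text \<open>The cycle on the vertices 0, ..., j - 1; it is a simple graph only for j at least 3.\<close>

definition cycle_graph :: "nat \<Rightarrow> nat graph" where
  "cycle_graph j = ({..<j}, {{i, Suc i mod j} | i. i < j})"

definition even_cycles :: "nat \<Rightarrow> nat graph set" where
  "even_cycles l = {cycle_graph (2 * i) | i. 2 \<le> i \<and> i \<le> l}"

text \<open>Every finite graph is isomorphic to one whose vertices are natural numbers, so it suffices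
  to maximise over graphs of that kind.\<close>

definition ex_num :: "nat \<Rightarrow> 'b graph set \<Rightarrow> nat" where
  "ex_num n F = Max {card (edges G) | G :: nat graph.
     simple_graph G \<and> card (verts G) = n \<and> free_of F G}"

definition z_num :: "nat \<Rightarrow> 'b graph set \<Rightarrow> nat" where
  "z_num n F = Max {card (edges G) | G :: nat graph.
     simple_graph G \<and> card (verts G) = n \<and> bipartite G \<and> free_of F G}"

text \<open>Both maxima are taken over finite sets, which are nonempty as long as every member of
  the family has an edge.\<close>

lemma simple_graph_card_edges_le:
  assumes "simple_graph G"
  shows "card (edges G) \<le> 2 ^ card (verts G)"
proof -
  have "edges G \<subseteq> Pow (verts G)" and "finite (verts G)"
    using assms unfolding simple_graph_def by auto
  then show ?thesis
    by (metis card_Pow card_mono finite_Pow_iff)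
qed

lemma finite_card_edges:
  "finite {card (edges G) | G :: nat graph. simple_graph G \<and> card (verts G) = n \<and> P G}"
  by (rule finite_subset[of _ "{..2 ^ n}"]) (auto dest: simple_graph_card_edges_le)

lemma free_bipartite_exists:
  assumes "\<And>H. H \<in> F \<Longrightarrow> edges H \<noteq> {}"
  shows "\<exists>G :: nat graph. simple_graph G \<and> card (verts G) = n \<and> bipartite G \<and> free_of F G"
proof -
  have "bipartite ({..<n}, {})"
    unfolding bipartite_def by (rule exI[of _ "{..<n}"], rule exI[of _ "{}"]) simp
  then show ?thesis
    using assms
    by (intro exI[of _ "({..<n}, {})"])
       (auto simp: simple_graph_def free_of_def contains_subgraph_def)
qed

end

(* In an extremal bipartite graph G pick a path a-b-c and add the edge ac. A cycle through ac comes
   from a path of even length m from a to c in G, so it is odd. If that path avoids b, then it closes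
   up through b to an even cycle of length m + 2; if it meets b, each of its two parts is an edge or
   closes up to an even cycle with the edge ab or bc. As G has no even cycle of length at most 2l,
   the new cycles have length 3 or more than 2l. If G has no path a-b-c, its edges are disjoint, and
   a star on n vertices has more edges. *)
theory Submission
  imports Defs "HOL-Number_Theory.Cong"
begin

section \<open>Paths given by an edge set and an enumeration of vertices\<close>

definition path_on :: "'a set set \<Rightarrow> (nat \<Rightarrow> 'a) \<Rightarrow> nat \<Rightarrow> bool" where
  "path_on E p j \<longleftrightarrow> inj_on p {..<j} \<and> (\<forall>i. Suc i < j \<longrightarrow> {p i, p (Suc i)} \<in> E)"

lemma path_on_inj: "path_on E p j \<Longrightarrow> i < j \<Longrightarrow> i' < j \<Longrightarrow> p i = p i' \<longleftrightarrow> i = i'"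
  unfolding path_on_def inj_on_def by auto

lemma path_on_edge: "path_on E p j \<Longrightarrow> Suc i < j \<Longrightarrow> {p i, p (Suc i)} \<in> E"
  unfolding path_on_def by auto

lemma path_on_take:
  assumes "path_on E p j" and "m \<le> j"
  shows "path_on E p m"
  using assms unfolding path_on_def by (auto intro: inj_on_subset)

lemma path_on_rev:
  assumes "path_on E p j"
  shows "path_on E (\<lambda>i. p (j - 1 - i)) j"
  unfolding path_on_def
proof (intro conjI allI impI)
  show "inj_on (\<lambda>i. p (j - 1 - i)) {..<j}"
    using assms by (auto intro!: inj_onI simp: path_on_inj)
  fix i assume "Suc i < j"
  then show "{p (j - 1 - i), p (j - 1 - Suc i)} \<in> E"
    using path_on_edge[OF assms, of "j - 1 - Suc i"]
    by (simp add: insert_commute Suc_diff_Suc)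
qed

lemma path_on_snoc:
  assumes p: "path_on E p j" and b: "b \<notin> p ` {..<j}" and e: "{p (j - 1), b} \<in> E"
  shows "path_on E (p(j := b)) (Suc j)"
  unfolding path_on_def
proof (intro conjI allI impI)
  show "inj_on (p(j := b)) {..<Suc j}"
    using p b unfolding path_on_def by (auto simp: lessThan_Suc inj_on_def)
  fix i assume i: "Suc i < Suc j"
  show "{(p(j := b)) i, (p(j := b)) (Suc i)} \<in> E"
  proof (cases "Suc i = j")
    case True
    then show ?thesis using e by auto
  next
    case False
    then show ?thesis using i path_on_edge[OF p, of i] by auto
  qed
qed

section \<open>Cycles as closed paths\<close>

lemma contains_cycle_iff:
  "contains_subgraph G (cycle_graph j) \<longleftrightarrow>
     (\<exists>f. inj_on f {..<j} \<and> f ` {..<j} \<subseteq> verts G \<and> (\<forall>i<j. f ` {i, Suc i mod j} \<in> edges G))"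
proof -
  have "(\<forall>e \<in> edges (cycle_graph j). f ` e \<in> edges G)
      \<longleftrightarrow> (\<forall>i<j. f ` {i, Suc i mod j} \<in> edges G)" for f
    unfolding cycle_graph_def snd_conv by blast
  then show ?thesis
    unfolding contains_subgraph_def by (simp only: cycle_graph_def fst_conv)
qed

lemma cycle_graph_has_edge: "0 < j \<Longrightarrow> edges (cycle_graph j) \<noteq> {}"
  unfolding cycle_graph_def by auto

lemma contains_cycleI:
  assumes G: "simple_graph G" and p: "path_on (edges G) p j"
    and j: "2 \<le> j" and e: "{p (j - 1), p 0} \<in> edges G"
  shows "contains_subgraph G (cycle_graph j)"
proof -
  have E: "p ` {i, Suc i mod j} \<in> edges G" if "i < j" for i
  proof (cases "Suc i = j")
    case True
    then have "i = j - 1" by simp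
    then show ?thesis using True e by auto
  next
    case False
    then show ?thesis using that path_on_edge[OF p, of i] by auto
  qed
  \<comment> \<open>\<open>path_on\<close> speaks of edges only; a vertex of \<open>p\<close> lies
    in \<open>verts G\<close> because an edge of the cycle contains it.\<close>
  have "p i \<in> verts G" if "i < j" for i
    using E[OF that] G unfolding simple_graph_def by auto
  then show ?thesis
    using p E unfolding contains_cycle_iff path_on_def by (intro exI[of _ p]) auto
qed

text \<open>A cycle that uses \<open>e\<close> can be cut open there: rotated so that
  \<open>e\<close> is its closing edge, it becomes a path whose edges all lie in
  \<open>E\<close>.\<close>

lemma cycle_cases_insert_edge:
  assumes c: "contains_subgraph (V, insert e E) (cycle_graph j)" and j: "3 \<le> j"
  obtains (old) "contains_subgraph (V, E) (cycle_graph j)"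
  | (new) p where "path_on E p j" "{p (j - 1), p 0} = e"
proof -
  obtain f where f: "inj_on f {..<j}" "f ` {..<j} \<subseteq> V"
    and fe: "\<And>i. i < j \<Longrightarrow> f ` {i, Suc i mod j} \<in> insert e E"
    using c unfolding contains_cycle_iff fst_conv snd_conv by blast
  have f_eq: "f x = f y \<longleftrightarrow> x = y" if "x < j" "y < j" for x y
    using f(1) that by (auto simp: inj_on_def)
  show thesis
  proof (cases "\<exists>i<j. f ` {i, Suc i mod j} = e")
    case False
    then have "contains_subgraph (V, E) (cycle_graph j)"
      using f fe unfolding contains_cycle_iff fst_conv snd_conv by (intro exI[of _ f]) blast
    then show thesis by (rule old)
  next
    case True
    then obtain s where s: "s < j" "f ` {s, Suc s mod j} = e" by blast
    \<comment> \<open>Renumbering that starts just after \<open>s\<close>, so that \<open>s\<close>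
      comes last and \<open>e\<close> joins the last vertex to the first.\<close>
    define t where "t i = (Suc s + i) mod j" for i
    have t: "t i < j" for i using j by (simp add: t_def)
    have t_Suc: "Suc (t i) mod j = t (Suc i)" for i
      by (simp add: t_def mod_Suc_eq)
    have t_eq: "t i = t i' \<longleftrightarrow> i = i'" if "i < j" "i' < j" for i i'
      using that cong_add_lcancel_nat[of "Suc s" i i' j] by (simp add: t_def cong_def)
    have t_last: "t (j - 1) = s" using s j by (simp add: t_def)
    have t_0: "t 0 = Suc s mod j" by (simp add: t_def)
    have "path_on E (\<lambda>i. f (t i)) j"
      unfolding path_on_def
    proof (intro conjI allI impI)
      show "inj_on (\<lambda>i. f (t i)) {..<j}"
        by (auto intro!: inj_onI simp: f_eq t t_eq)
      fix i assume i: "Suc i < j"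
      \<comment> \<open>On a cycle with at least three vertices no other edge has the same two ends
        as the closing one, so the edges of the path differ from \<open>e\<close>.\<close>
      have "{f (t i), f (t (Suc i))} \<noteq> {f (t (j - 1)), f (t 0)}"
        using i j by (auto simp: doubleton_eq_iff f_eq t t_eq)
      moreover have "{f (t (j - 1)), f (t 0)} = e"
        using s(2) unfolding t_last t_0 by simp
      ultimately show "{f (t i), f (t (Suc i))} \<in> E"
        using fe[OF t, of i] by (simp add: t_Suc)
    qed
    moreover have "{f (t (j - 1)), f (t 0)} = e"
      using s(2) unfolding t_last t_0 by simp
    ultimately show thesis by (rule new)
  qed
qed

lemma contains_cycleE:
  assumes c: "contains_subgraph G (cycle_graph j)" and j: "2 \<le> j"
  obtains p where "path_on (edges G) p j" "{p (j - 1), p 0} \<in> edges G"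
proof -
  obtain f where f: "inj_on f {..<j}"
    and fe: "\<And>i. i < j \<Longrightarrow> f ` {i, Suc i mod j} \<in> edges G"
    using c unfolding contains_cycle_iff by blast
  have "path_on (edges G) f j"
    using f fe unfolding path_on_def by (metis Suc_lessD image_empty image_insert mod_less)
  moreover have "{f (j - 1), f 0} \<in> edges G"
    using fe[of "j - 1"] j by simp
  ultimately show thesis by (rule that)
qed

section \<open>Parity along paths in bipartite graphs\<close>

lemma bipartite_side:
  assumes "bipartite G"
  obtains A where "\<And>u v. {u, v} \<in> edges G \<Longrightarrow> u \<in> A \<longleftrightarrow> v \<notin> A"
proof -
  obtain A B where AB: "A \<inter> B = {}"
    and e: "\<forall>e \<in> edges G. \<exists>a \<in> A. \<exists>b \<in> B. e = {a, b}"
    using assms unfolding bipartite_def by blast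
  have "u \<in> A \<longleftrightarrow> v \<notin> A" if "{u, v} \<in> edges G" for u v
    using e that AB by (fastforce simp: doubleton_eq_iff)
  then show thesis by (rule that)
qed

text \<open>Each edge changes sides. Comparing two vertices of a path thus yields the parity of the
  distance between them, which decides the parity of cycles below.\<close>

lemma path_on_alternates:
  assumes A: "\<And>u v. {u, v} \<in> E \<Longrightarrow> u \<in> A \<longleftrightarrow> v \<notin> A" and p: "path_on E p j" and "i < j"
  shows "p i \<in> A \<longleftrightarrow> (even i \<longleftrightarrow> p 0 \<in> A)"
  using \<open>i < j\<close>
proof (induction i)
  case (Suc i)
  then show ?case using A[OF path_on_edge[OF p, of i]] by auto
qed simp

section \<open>Adding the edge that closes a triangle\<close>

lemma free_of_insert_triangle_edge:
  assumes G: "simple_graph (V, E)" and bip: "bipartite (V, E)"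
    and free: "free_of (even_cycles l) (V, E)"
    and k: "odd k" "5 \<le> k" "k < 2 * l"
    and ab: "{a, b} \<in> E" and bc: "{b, c} \<in> E"
  shows "free_of (even_cycles l \<union> {cycle_graph k}) (V, insert {a, c} E)"
proof -
  obtain A where A: "\<And>u v. {u, v} \<in> E \<Longrightarrow> u \<in> A \<longleftrightarrow> v \<notin> A"
    using bipartite_side[OF bip] by auto
  have no_even: "\<not> contains_subgraph (V, E) (cycle_graph j)"
    if "even j" "4 \<le> j" "j \<le> 2 * l" for j
  proof -
    obtain i where "j = 2 * i" using \<open>even j\<close> by blast
    then have "cycle_graph j \<in> even_cycles l"
      using that unfolding even_cycles_def by auto
    then show ?thesis using free unfolding free_of_def by blast
  qed
  \<comment> \<open>The case of \<open>b\<close> on the path: its segment from \<open>p 0\<close> to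
    \<open>b\<close> has odd length \<open>m\<close>, so unless it is a single edge, the edge from
    \<open>b\<close> back to \<open>p 0\<close> closes it to an even cycle of length
    \<open>m + 1 \<le> k < 2 * l\<close>.\<close>
  have close_up: "m = 1"
    if p: "path_on E p k" and p0: "{p 0, b} \<in> E" and m: "p m = b" "m < k" for p m
  proof (rule ccontr)
    assume "m \<noteq> 1"
    have "odd m"
      using path_on_alternates[OF A p m(2)] A[OF p0] m(1) by auto
    then have "m \<ge> 3" using \<open>m \<noteq> 1\<close> by (cases "m = 2") (auto elim: oddE)
    have "path_on E p (Suc m)" using path_on_take[OF p] m by simp
    then have "contains_subgraph (V, E) (cycle_graph (Suc m))"
      using contains_cycleI[OF G, of p "Suc m"] p0 m \<open>m \<ge> 3\<close> by (simp add: insert_commute)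
    then show False
      using no_even[of "Suc m"] \<open>odd m\<close> \<open>m \<ge> 3\<close> m k by auto
  qed
  \<comment> \<open>All forbidden lengths are handled together; parity then leaves only even
    \<open>j\<close> for old cycles and only \<open>j = k\<close> for new ones.\<close>
  have "\<not> contains_subgraph (V, insert {a, c} E) (cycle_graph j)"
    if j: "j = k \<or> even j \<and> 4 \<le> j \<and> j \<le> 2 * l" for j
  proof
    assume cyc: "contains_subgraph (V, insert {a, c} E) (cycle_graph j)"
    have "3 \<le> j" using j k by auto
    from cyc \<open>3 \<le> j\<close> show False
    proof (cases rule: cycle_cases_insert_edge)
      case old
      then obtain p where p: "path_on E p j" "{p (j - 1), p 0} \<in> E"
        using contains_cycleE[of "(V, E)" j] \<open>3 \<le> j\<close> by auto
      have "even j"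
        using path_on_alternates[OF A p(1), of "j - 1"] A[OF p(2)] \<open>3 \<le> j\<close> by auto
      then show False using old no_even j k by blast
    next
      case (new p)
      \<comment> \<open>In whichever direction the new edge is traversed, both ends of the path are
        neighbours of \<open>b\<close>, hence on the same side.\<close>
      then have ends: "{p 0, b} \<in> E" "{p (j - 1), b} \<in> E"
        using ab bc by (auto simp: doubleton_eq_iff insert_commute)
      have "odd j"
        using path_on_alternates[OF A new(1), of "j - 1"] A[OF ends(1)] A[OF ends(2)] \<open>3 \<le> j\<close>
        by auto
      then have "j = k" using j by blast
      note p = new(1)[unfolded \<open>j = k\<close>] and ends = ends[unfolded \<open>j = k\<close>]
      show False
      proof (cases "b \<in> p ` {..<k}")
        case False
        \<comment> \<open>Appending \<open>b\<close> gives a cycle of even length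
          \<open>k + 1\<close>, which is at most \<open>2 * l\<close>.\<close>
        then have "path_on E (p(k := b)) (Suc k)"
          using path_on_snoc p ends(2) by metis
        then have "contains_subgraph (V, E) (cycle_graph (Suc k))"
          using contains_cycleI[OF G, of "p(k := b)" "Suc k"] ends(1) k
          by (simp add: insert_commute)
        then show False using no_even[of "Suc k"] k by auto
      next
        case True
        then obtain m where m: "p m = b" "m < k" by auto
        \<comment> \<open>Applied to the path and to its reverse, \<open>close_up\<close> makes
          \<open>b\<close> adjacent along the path to both ends. This forces \<open>k = 3\<close>,
          against \<open>5 \<le> k\<close>.\<close>
        have "m = 1" by (rule close_up[OF p ends(1) m])
        moreover have "k - 1 - m = 1"
          by (rule close_up[OF path_on_rev[OF p]]) (use ends m in auto)
        ultimately show False using k by simp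
      qed
    qed
  qed
  then show ?thesis using k unfolding free_of_def even_cycles_def by fastforce
qed

section \<open>Matchings and stars\<close>

lemma card_matching_le:
  assumes G: "simple_graph (V, E)" and disj: "\<And>e e'. e \<in> E \<Longrightarrow> e' \<in> E \<Longrightarrow> e \<noteq> e' \<Longrightarrow> e \<inter> e' = {}"
  shows "2 * card E \<le> card V"
proof -
  have V: "finite V" "\<Union>E \<subseteq> V" and c: "\<And>e. e \<in> E \<Longrightarrow> card e = 2"
    using G unfolding simple_graph_def by auto
  have "card (\<Union>E) = (\<Sum>e\<in>E. card e)"
    using disj c by (intro card_Union_disjoint) (auto simp: pairwise_def disjnt_def card_ge_0_finite)
  also have "\<dots> = 2 * card E" using c by simp
  finally show ?thesis using card_mono[OF V] by simp
qed

text \<open>A cycle of length at least 4 has two disjoint edges, the first and the third. The lemma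
  is meant for stars, whose edges share the centre.\<close>

lemma intersecting_no_cycle:
  assumes "\<And>e e'. e \<in> E \<Longrightarrow> e' \<in> E \<Longrightarrow> e \<inter> e' \<noteq> {}" and "4 \<le> j"
  shows "\<not> contains_subgraph (V, E) (cycle_graph j)"
proof
  assume "contains_subgraph (V, E) (cycle_graph j)"
  then obtain p where p: "path_on E p j"
    using contains_cycleE[of "(V, E)" j] \<open>4 \<le> j\<close> by auto
  have "{p 0, p 1} \<inter> {p 2, p 3} \<noteq> {}"
    using assms(1) path_on_edge[OF p, of 0] path_on_edge[OF p, of 2] \<open>4 \<le> j\<close>
    by (auto simp: numeral_eq_Suc)
  then show False using \<open>4 \<le> j\<close> by (auto simp: path_on_inj[OF p])
qed

section \<open>The extremal numbers and the conclusion\<close>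

lemma ex_num_ge:
  fixes G :: "nat graph"
  assumes "simple_graph G" and "free_of F G"
  shows "card (edges G) \<le> ex_num (card (verts G)) F"
  unfolding ex_num_def by (rule Max_ge[OF finite_card_edges]) (use assms in \<open>intro CollectI exI[of _ G], simp\<close>)

lemma z_num_attained:
  assumes "\<And>H. H \<in> F \<Longrightarrow> edges H \<noteq> {}"
  obtains G :: "nat graph" where "simple_graph G" "card (verts G) = n" "bipartite G" "free_of F G"
    "card (edges G) = z_num n F"
proof -
  let ?S = "{card (edges G) | G :: nat graph.
     simple_graph G \<and> card (verts G) = n \<and> bipartite G \<and> free_of F G}"
  have "z_num n F \<in> ?S"
    unfolding z_num_def
    by (rule Max_in[OF finite_card_edges]) (use free_bipartite_exists[of F n] assms in auto)
  then show thesis using that by force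
qed

lemma ex_num_ge_star:
  assumes F: "\<And>H. H \<in> F \<Longrightarrow> \<exists>j\<ge>4. H = cycle_graph j" and "n \<ge> 1"
  shows "n - 1 \<le> ex_num n F"
proof -
  \<comment> \<open>The star with centre 0.\<close>
  let ?E = "(\<lambda>i. {0, i}) ` {1..<n}"
  have "simple_graph ({..<n}, ?E)"
    using \<open>n \<ge> 1\<close> unfolding simple_graph_def by auto
  moreover have "free_of F ({..<n}, ?E)"
    unfolding free_of_def
  proof
    fix H assume "H \<in> F"
    then obtain j where j: "j \<ge> 4" "H = cycle_graph j" using F by blast
    show "\<not> contains_subgraph ({..<n}, ?E) H"
      unfolding j(2) by (rule intersecting_no_cycle[OF _ j(1)]) auto
  qed
  moreover have "card ?E = n - 1"
    by (subst card_image) (auto simp: inj_on_def doubleton_eq_iff)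
  ultimately show ?thesis using ex_num_ge[of "({..<n}, ?E)" F] by simp
qed

theorem mainTheorem5:
  fixes l k n :: nat
  assumes "odd k" and "5 \<le> k" and "k < 2 * l" and "n \<ge> 3"
  shows "ex_num n (even_cycles l \<union> {cycle_graph k}) \<ge> z_num n (even_cycles l) + 1"
proof -
  have "edges H \<noteq> {}" if "H \<in> even_cycles l" for H
    using that cycle_graph_has_edge unfolding even_cycles_def by force
  then obtain G :: "nat graph" where G': "simple_graph G" "card (verts G) = n" "bipartite G"
      "free_of (even_cycles l) G" "card (edges G) = z_num n (even_cycles l)"
    using z_num_attained by blast
  obtain V E where VE: "G = (V, E)" by (cases G)
  note G = G'[unfolded VE, simplified]
  show ?thesis
  proof (cases "\<exists>a b c. a \<noteq> c \<and> {a, b} \<in> E \<and> {b, c} \<in> E")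
    case True
    then obtain a b c where abc: "a \<noteq> c" "{a, b} \<in> E" "{b, c} \<in> E" by blast
    obtain A where A: "\<And>u v. {u, v} \<in> E \<Longrightarrow> u \<in> A \<longleftrightarrow> v \<notin> A"
      using bipartite_side[OF G(3)] by auto
    \<comment> \<open>Both \<open>a\<close> and \<open>c\<close> lie on the side opposite to
      \<open>b\<close>, so the added edge is new and raises the number of edges by one.\<close>
    have "{a, c} \<notin> E" using A abc by metis
    moreover have "E \<subseteq> Pow V" "finite V" using G(1) unfolding simple_graph_def by auto
    then have "finite E" using finite_subset by blast
    moreover have "simple_graph (V, insert {a, c} E)"
      using G(1) abc unfolding simple_graph_def by fastforce
    ultimately show ?thesis
      using ex_num_ge[OF _ free_of_insert_triangle_edge[OF G(1,3,4) assms(1-3) abc(2,3)]] G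
      by simp
  next
    case False
    have "e \<inter> e' = {}" if e: "e \<in> E" "e' \<in> E" "e \<noteq> e'" for e e'
    proof (rule ccontr)
      assume "e \<inter> e' \<noteq> {}"
      then obtain b where b: "b \<in> e" "b \<in> e'" by blast
      have "card e = 2" "card e' = 2" using G(1) e unfolding simple_graph_def by auto
      then obtain a c where "e = {a, b}" "e' = {b, c}"
        using b by (auto simp: card_2_iff insert_commute)
      then show False using False e by (metis insert_commute)
    qed
    then have "2 * z_num n (even_cycles l) \<le> n"
      using card_matching_le[OF G(1)] G by simp
    moreover have "n - 1 \<le> ex_num n (even_cycles l \<union> {cycle_graph k})"
    proof (rule ex_num_ge_star)
      fix H assume "H \<in> even_cycles l \<union> {cycle_graph k}"
      then show "\<exists>j\<ge>4. H = cycle_graph j"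
      proof
        assume "H \<in> even_cycles l"
        then obtain i where "2 \<le> i" "H = cycle_graph (2 * i)"
          unfolding even_cycles_def by blast
        then show ?thesis by (intro exI[of _ "2 * i"]) simp
      next
        assume "H \<in> {cycle_graph k}"
        then show ?thesis using assms(2) by (intro exI[of _ k]) simp
      qed
    qed (use assms in simp)
    \<comment> \<open>With \<open>z\<close> edges in the matching, \<open>2 * z \<le> n\<close>
      gives \<open>z + 1 \<le> n - 1\<close> once \<open>n \<ge> 3\<close>; for \<open>n = 2\<close>
      and \<open>z = 1\<close> this would fail.\<close>
    ultimately show ?thesis using \<open>n \<ge> 3\<close> by linarith
  qed
qed

end
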